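(* Let $\alpha\in\mathbb{C}$ with $|\alpha|\le 1$, $\alpha\ne -1$. Let $\phi$ and $\omega$ be Schwarz functions and let $\psi=\frac{1+\alpha\omega}{1-\omega}$ on $\mathbb{D}$. Then the weighted composition operator $C_{\psi,\phi}$ preserves the class $\mathcal{P}_\alpha$ if and only if $$2\,Q(\omega)\,|\phi| < (1-|\omega|^2)+P(\omega)\,|\phi|^2 \quad\text{at every point of } \mathbb{D},$$ where $P(\omega)=|\alpha\omega|^2-|1+(\alpha-1)\omega|^2$ and $Q(\omega)=\left|(\alpha-1)|\omega|^2+\overline{\omega}-\alpha\omega\right|$ (all evaluated pointwise on $\mathbb{D}$).
   Context: $\mathbb{D}=\{z\in\mathbb{C}:|z|<1\}$ and $\mathcal{H}(\mathbb{D})$ is the set of analytic functions on $\mathbb{D}$. A Schwarz function is an analytic function $\omega:\mathbb{D}\to\mathbb{D}$ with $\omega(0)=0$. For $f,g\in\mathcal{H}(\mathbb{D})$, $f\prec g$ ($f$ is subordinate to $g$) means $f=g\circ\omega$ for some Schwarz function $\omega$. For $|\alpha|\le1$, $\alpha\neq-1$, put $h_\alpha(z)=\frac{1+\alpha z}{1-z}$ and $\mathcal{P}_\alpha=\{f\in\mathcal{H}(\mathbb{D}): f\prec h_\alpha\}$. For $\psi\in\mathcal{H}(\mathbb{D})$ and an analytic self-map $\phi$ of $\mathbb{D}$, the weighted composition operator is $C_{\psi,\phi}(f)=\psi\,(f\circ\phi)$, $f\in\mathcal{H}(\mathbb{D})$. It preserves $\mathcal{P}_\alpha$ if $C_{\psi,\phi}(\mathcal{P}_\alpha)\subset\mathcal{P}_\alpha$.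 *)

theory Defs
  imports "HOL-Complex_Analysis.Complex_Analysis"
begin

text \<open>
  Functions on the unit disc are total functions of type \<^typ>\<open>complex \<Rightarrow> complex\<close>; every notion
  below depends only on their values on the disc.
\<close>

abbreviation unit_disc :: "complex set" where
  "unit_disc \<equiv> ball 0 1"

definition schwarz_function :: "(complex \<Rightarrow> complex) \<Rightarrow> bool" where
  "schwarz_function \<omega> \<longleftrightarrow>
     \<omega> holomorphic_on unit_disc \<and> \<omega> ` unit_disc \<subseteq> unit_disc \<and> \<omega> 0 = 0"

definition subordinate :: "(complex \<Rightarrow> complex) \<Rightarrow> (complex \<Rightarrow> complex) \<Rightarrow> bool" where
  "subordinate f g \<longleftrightarrow>
     (\<exists>\<omega>. schwarz_function \<omega> \<and> (\<forall>z\<in>unit_disc. f z = g (\<omega> z)))"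

definition h_fun :: "complex \<Rightarrow> complex \<Rightarrow> complex" where
  "h_fun \<alpha> z = (1 + \<alpha> * z) / (1 - z)"

definition class_P :: "complex \<Rightarrow> (complex \<Rightarrow> complex) set" where
  "class_P \<alpha> = {f. f holomorphic_on unit_disc \<and> subordinate f (h_fun \<alpha>)}"

definition weighted_comp ::
    "(complex \<Rightarrow> complex) \<Rightarrow> (complex \<Rightarrow> complex) \<Rightarrow> (complex \<Rightarrow> complex) \<Rightarrow> complex \<Rightarrow> complex" where
  "weighted_comp \<psi> \<phi> f = (\<lambda>z. \<psi> z * f (\<phi> z))"

definition preserves_class_P ::
    "(complex \<Rightarrow> complex) \<Rightarrow> (complex \<Rightarrow> complex) \<Rightarrow> complex \<Rightarrow> bool" where
  "preserves_class_P \<psi> \<phi> \<alpha> \<longleftrightarrow> weighted_comp \<psi> \<phi> ` class_P \<alpha> \<subseteq> class_P \<alpha>"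

definition P_term :: "complex \<Rightarrow> complex \<Rightarrow> real" where
  "P_term \<alpha> w = (cmod (\<alpha> * w))\<^sup>2 - (cmod (1 + (\<alpha> - 1) * w))\<^sup>2"

definition Q_term :: "complex \<Rightarrow> complex \<Rightarrow> real" where
  "Q_term \<alpha> w = cmod ((\<alpha> - 1) * of_real ((cmod w)\<^sup>2) + cnj w - \<alpha> * w)"

end

theory Submission
  imports Defs
begin

text \<open>
  The Moebius map \<open>h_fun \<alpha>\<close> sends the disc onto \<open>{w. cmod (w - 1) < cmod (w + \<alpha>)}\<close>, so
  membership in the class is a pointwise condition. By the Schwarz lemma the
  values \<open>f (\<phi> z)\<close>, for \<open>f\<close> in the class, are the \<open>h_fun \<alpha> v\<close> with \<open>cmod v \<le> cmod (\<phi> z)\<close>, so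
  the operator preserves the class iff \<open>h_fun \<alpha> (\<omega> z) * h_fun \<alpha> v\<close> lies in the image of the disc
  for all these \<open>v\<close>. This amounts to positivity of
  \<open>1 - |\<omega>|^2 + P |v|^2 - 2 Re (v q)\<close>, where \<open>Q = |q|\<close>; minimising over the argument of \<open>v\<close>
  leaves \<open>F r = 1 - |\<omega>|^2 + P r^2 - 2 Q r > 0\<close> for all \<open>0 \<le> r \<le> |\<phi> z|\<close>. Because \<open>h_fun \<alpha>\<close> has
  its pole at \<open>1\<close>, \<open>F 1 \<le> 0\<close>; this makes positivity at the
  endpoint \<open>r = |\<phi> z|\<close> sufficient, by convexity if \<open>P > 0\<close> and by monotonicity otherwise.
\<close>

lemma holomorphic_on_h_fun: "h_fun \<alpha> holomorphic_on unit_disc"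
  unfolding h_fun_def by (intro holomorphic_intros) auto

lemma h_fun_minus_1: "z \<noteq> 1 \<Longrightarrow> h_fun \<alpha> z - 1 = (\<alpha> + 1) * z / (1 - z)"
  and h_fun_plus: "z \<noteq> 1 \<Longrightarrow> h_fun \<alpha> z + \<alpha> = (\<alpha> + 1) / (1 - z)"
  by (simp_all add: h_fun_def field_simps)

text \<open>The inverse of \<open>h_fun \<alpha>\<close> is w -> (w - 1) / (w + \<alpha>), so the
  only candidate for a subordinating function is (f - 1) / (f + \<alpha>). The inequality puts its
  values in the disc, and f 0 = 1 makes it vanish at 0.\<close>

lemma class_P_iff:
  assumes "\<alpha> \<noteq> -1"
  shows "f \<in> class_P \<alpha> \<longleftrightarrow>
    f holomorphic_on unit_disc \<and> f 0 = 1 \<and> (\<forall>z\<in>unit_disc. cmod (f z - 1) < cmod (f z + \<alpha>))"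
proof (intro iffI conjI ballI)
  assume f: "f \<in> class_P \<alpha>"
  then obtain u where u: "schwarz_function u" "\<And>z. z \<in> unit_disc \<Longrightarrow> f z = h_fun \<alpha> (u z)"
    by (auto simp: class_P_def subordinate_def)
  show "f holomorphic_on unit_disc"
    using f by (simp add: class_P_def)
  show "f 0 = 1"
    using u by (simp add: schwarz_function_def h_fun_def)
  fix z :: complex assume z: "z \<in> unit_disc"
  have uz: "cmod (u z) < 1" "u z \<noteq> 1"
    using u(1) z by (force simp: schwarz_function_def)+
  have "\<alpha> + 1 \<noteq> 0"
    using assms by (simp add: add_eq_0_iff2)
  then show "cmod (f z - 1) < cmod (f z + \<alpha>)"
    using uz
    by (simp add: u(2)[OF z] h_fun_minus_1 h_fun_plus norm_mult norm_divide divide_strict_right_mono)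
next
  assume f: "f holomorphic_on unit_disc \<and> f 0 = 1 \<and>
    (\<forall>z\<in>unit_disc. cmod (f z - 1) < cmod (f z + \<alpha>))"
  define u where "u z = (f z - 1) / (f z + \<alpha>)" for z
  have nz: "f z + \<alpha> \<noteq> 0" if "z \<in> unit_disc" for z
    using f that by fastforce
  have "u holomorphic_on unit_disc"
    unfolding u_def using f nz by (intro holomorphic_intros) auto
  moreover have "cmod (u z) < 1" if "z \<in> unit_disc" for z
    using f nz that by (simp add: u_def norm_divide)
  ultimately have "schwarz_function u"
    using f by (auto simp: schwarz_function_def u_def)
  moreover have "f z = h_fun \<alpha> (u z)" if "z \<in> unit_disc" for z
  proof -
    have "1 + \<alpha> * u z = (1 + \<alpha>) * f z / (f z + \<alpha>)" "1 - u z = (1 + \<alpha>) / (f z + \<alpha>)"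
      using nz[OF that] by (simp_all add: u_def field_simps)
    moreover have "1 + \<alpha> \<noteq> 0"
      using assms by (metis add_eq_0_iff)
    ultimately show ?thesis
      using nz[OF that] by (simp add: h_fun_def)
  qed
  ultimately show "f \<in> class_P \<alpha>"
    using f by (auto simp: class_P_def subordinate_def)
qed

lemma h_fun_compose_in_class_P:
  assumes "schwarz_function u"
  shows "(\<lambda>z. h_fun \<alpha> (u z)) \<in> class_P \<alpha>"
proof -
  have "(h_fun \<alpha> \<circ> u) holomorphic_on unit_disc"
    using assms holomorphic_on_h_fun
    by (intro holomorphic_on_compose_gen[where t = unit_disc])
       (auto simp: schwarz_function_def)
  then show ?thesis
    using assms by (auto simp: class_P_def subordinate_def o_def)
qed

text \<open>Over the common denominator, both sides share the nonzero factor (\<alpha> + 1) / ((1 -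
  w) * (1 - v)), which cancels.\<close>

lemma h_fun_mult_condition:
  assumes "\<alpha> \<noteq> -1" "w \<noteq> 1" "v \<noteq> 1"
  shows "cmod (h_fun \<alpha> w * h_fun \<alpha> v - 1) < cmod (h_fun \<alpha> w * h_fun \<alpha> v + \<alpha>) \<longleftrightarrow>
    cmod (w + v + (\<alpha> - 1) * w * v) < cmod (1 + \<alpha> * w * v)"
proof -
  have nz: "(1 - w) * (1 - v) \<noteq> 0" "\<alpha> + 1 \<noteq> 0"
    using assms by (auto simp: add_eq_0_iff2)
  have "h_fun \<alpha> w * h_fun \<alpha> v - 1
      = (\<alpha> + 1) / ((1 - w) * (1 - v)) * (w + v + (\<alpha> - 1) * w * v)"
    using nz by (simp add: h_fun_def divide_simps) algebra
  moreover have "h_fun \<alpha> w * h_fun \<alpha> v + \<alpha>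
      = (\<alpha> + 1) / ((1 - w) * (1 - v)) * (1 + \<alpha> * w * v)"
    using nz by (simp add: h_fun_def divide_simps) algebra
  moreover have "cmod ((\<alpha> + 1) / ((1 - w) * (1 - v))) > 0"
    using nz by simp
  ultimately show ?thesis
    by (simp only: norm_mult mult_less_cancel_left_pos)
qed

text \<open>Write w + v + (\<alpha> - 1) * w * v as w + v * (1 + (\<alpha> - 1) * w) and expand both
  squares in v: the terms in |v|^2 combine to \<open>P_term\<close>, and the cross terms to a single
  real part.\<close>

lemma norm_diff_identity:
  "(cmod (1 + \<alpha> * w * v))\<^sup>2 - (cmod (w + v + (\<alpha> - 1) * w * v))\<^sup>2 =
    1 - (cmod w)\<^sup>2 + P_term \<alpha> w * (cmod v)\<^sup>2
      - 2 * Re (v * ((\<alpha> - 1) * of_real ((cmod w)\<^sup>2) + cnj w - \<alpha> * w))"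
  unfolding P_term_def cmod_power2
  by (simp add: algebra_simps power2_eq_square)

lemma exists_rotation:
  obtains e where "cmod e = 1" "e * q = of_real (cmod q)"
proof (cases "q = 0")
  case True
  then show ?thesis
    using that[of 1] by simp
next
  case False
  then show ?thesis
    using that[of "cnj q / of_real (cmod q)"] complex_norm_square[of q]
    by (simp add: norm_divide power2_eq_square field_simps)
qed

text \<open>For r \<ge> 0 this is the minimum of the difference in \<open>norm_diff_identity\<close>
  over the circle |v| = r. \<open>F_term_le\<close> gives the bound and
  \<open>F_term_attained\<close> a minimiser.\<close>

definition F_term :: "complex \<Rightarrow> complex \<Rightarrow> real \<Rightarrow> real" where
  "F_term \<alpha> w r = 1 - (cmod w)\<^sup>2 + P_term \<alpha> w * r\<^sup>2 - 2 * Q_term \<alpha> w * r"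

lemma F_term_le:
  "F_term \<alpha> w (cmod v) \<le>
    (cmod (1 + \<alpha> * w * v))\<^sup>2 - (cmod (w + v + (\<alpha> - 1) * w * v))\<^sup>2"
proof -
  define q where "q = (\<alpha> - 1) * of_real ((cmod w)\<^sup>2) + cnj w - \<alpha> * w"
  have "Re (v * q) \<le> cmod q * cmod v"
    using complex_Re_le_cmod[of "v * q"] by (simp only: norm_mult mult.commute)
  then show ?thesis
    unfolding norm_diff_identity F_term_def Q_term_def q_def[symmetric] by linarith
qed

lemma F_term_attained:
  obtains e where "cmod e = 1"
    "F_term \<alpha> w (cmod v) =
      (cmod (1 + \<alpha> * w * (e * v)))\<^sup>2 - (cmod (w + e * v + (\<alpha> - 1) * w * (e * v)))\<^sup>2"
proof -
  define q where "q = (\<alpha> - 1) * of_real ((cmod w)\<^sup>2) + cnj w - \<alpha> * w"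
  \<comment> \<open>Turning v * q onto the nonnegative real axis gives equality in Re \<le>
    cmod.\<close>
  obtain e where e: "cmod e = 1" "e * (v * q) = of_real (cmod (v * q))"
    by (rule exists_rotation)
  have "Re (e * v * q) = cmod q * cmod v"
    by (simp only: mult.assoc e(2) Re_complex_of_real norm_mult mult.commute[of "cmod v"])
  then show ?thesis
    using that[OF e(1)] e(1)
    unfolding norm_diff_identity F_term_def Q_term_def q_def[symmetric]
    by (simp only: norm_mult mult_1 mult.assoc)
qed

text \<open>At v = 1 both norms equal |1 + \<alpha> * w|, so the difference that bounds
  \<open>F_term\<close> is zero.\<close>

lemma F_term_1_nonpos: "F_term \<alpha> w 1 \<le> 0"
  using F_term_le[of \<alpha> w 1] by (simp add: algebra_simps)

lemma F_term_pos_mono: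
  assumes r: "0 \<le> r" "r \<le> s" "s < 1" and pos: "F_term \<alpha> w s > 0"
  shows "F_term \<alpha> w r > 0"
proof (cases "P_term \<alpha> w > 0")
  case True
  have "convex_on {r..1} (F_term \<alpha> w)"
  proof (rule f''_ge0_imp_convex)
    show "(F_term \<alpha> w has_real_derivative 2 * P_term \<alpha> w * x - 2 * Q_term \<alpha> w) (at x)" for x
      unfolding F_term_def by (auto intro!: derivative_eq_intros)
    show "((\<lambda>x. 2 * P_term \<alpha> w * x - 2 * Q_term \<alpha> w) has_real_derivative 2 * P_term \<alpha> w) (at x)"
      for x by (auto intro!: derivative_eq_intros)
  qed (use True in auto)
  \<comment> \<open>A convex function on [r, 1] lies below its larger endpoint value. The value at 1
    is not positive, so the positive value at s must be bounded by the one at r.\<close>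
  then have "F_term \<alpha> w s \<le> max (F_term \<alpha> w r) (F_term \<alpha> w 1)"
    by (rule convex_on_le_max) (use r in auto)
  then show ?thesis
    using pos F_term_1_nonpos[of \<alpha> w] by linarith
next
  case False
  have "r\<^sup>2 \<le> s\<^sup>2"
    using r by (simp add: power_mono)
  then have "P_term \<alpha> w * s\<^sup>2 \<le> P_term \<alpha> w * r\<^sup>2"
    using False by (simp add: mult_left_mono_neg)
  moreover have "Q_term \<alpha> w * r \<le> Q_term \<alpha> w * s"
    using r by (simp add: Q_term_def mult_left_mono)
  ultimately show ?thesis
    using pos by (simp add: F_term_def)
qed

theorem theorem1:
  fixes \<alpha> :: complex and \<phi> \<omega> \<psi> :: "complex \<Rightarrow> complex"
  assumes "cmod \<alpha> \<le> 1" and "\<alpha> \<noteq> -1"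
    and "schwarz_function \<phi>" and "schwarz_function \<omega>"
    and "\<And>z. z \<in> unit_disc \<Longrightarrow> \<psi> z = (1 + \<alpha> * \<omega> z) / (1 - \<omega> z)"
  shows "preserves_class_P \<psi> \<phi> \<alpha> \<longleftrightarrow>
    (\<forall>z\<in>unit_disc.
       2 * Q_term \<alpha> (\<omega> z) * cmod (\<phi> z)
         < (1 - (cmod (\<omega> z))\<^sup>2) + P_term \<alpha> (\<omega> z) * (cmod (\<phi> z))\<^sup>2)"
proof -
  have \<psi>: "\<psi> z = h_fun \<alpha> (\<omega> z)" if "z \<in> unit_disc" for z
    using assms(5)[OF that] by (simp add: h_fun_def)
  have \<phi>: "cmod (\<phi> z) < 1" and \<omega>: "\<omega> z \<noteq> 1" if "z \<in> unit_disc" for z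
    using assms(3,4) that by (force simp: schwarz_function_def)+
  have "preserves_class_P \<psi> \<phi> \<alpha> \<longleftrightarrow> (\<forall>z\<in>unit_disc. F_term \<alpha> (\<omega> z) (cmod (\<phi> z)) > 0)"
  proof (intro iffI ballI)
    fix z :: complex assume pres: "preserves_class_P \<psi> \<phi> \<alpha>" and z: "z \<in> unit_disc"
    obtain e where e: "cmod e = 1" "F_term \<alpha> (\<omega> z) (cmod (\<phi> z)) =
        (cmod (1 + \<alpha> * \<omega> z * (e * \<phi> z)))\<^sup>2
        - (cmod (\<omega> z + e * \<phi> z + (\<alpha> - 1) * \<omega> z * (e * \<phi> z)))\<^sup>2"
      by (rule F_term_attained)
    \<comment> \<open>Rotations of \<open>h_fun \<alpha>\<close> serve as test functions: with e
      chosen for this z, evaluation at \<open>\<phi> z\<close> hits the minimising v = e *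
      \<open>\<phi> z\<close>.\<close>
    have "schwarz_function (\<lambda>\<zeta>. e * \<zeta>)"
      using e(1) by (auto simp: schwarz_function_def norm_mult intro!: holomorphic_intros)
    then have "weighted_comp \<psi> \<phi> (\<lambda>\<zeta>. h_fun \<alpha> (e * \<zeta>)) \<in> class_P \<alpha>"
      using pres h_fun_compose_in_class_P unfolding preserves_class_P_def by blast
    then have "cmod (h_fun \<alpha> (\<omega> z) * h_fun \<alpha> (e * \<phi> z) - 1)
        < cmod (h_fun \<alpha> (\<omega> z) * h_fun \<alpha> (e * \<phi> z) + \<alpha>)"
      using z by (simp add: class_P_iff[OF assms(2)] weighted_comp_def \<psi>)
    moreover have "e * \<phi> z \<noteq> 1"
      using e(1) \<phi>[OF z] by (metis less_irrefl mult_1 norm_mult norm_one)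
    ultimately have "cmod (\<omega> z + e * \<phi> z + (\<alpha> - 1) * \<omega> z * (e * \<phi> z))
        < cmod (1 + \<alpha> * \<omega> z * (e * \<phi> z))"
      using h_fun_mult_condition[OF assms(2) \<omega>[OF z]] by blast
    then show "F_term \<alpha> (\<omega> z) (cmod (\<phi> z)) > 0"
      by (simp add: e(2) power_strict_mono)
  next
    assume pos: "\<forall>z\<in>unit_disc. F_term \<alpha> (\<omega> z) (cmod (\<phi> z)) > 0"
    have "weighted_comp \<psi> \<phi> f \<in> class_P \<alpha>" if f: "f \<in> class_P \<alpha>" for f
    proof -
      obtain u where u: "schwarz_function u" "\<And>z. z \<in> unit_disc \<Longrightarrow> f z = h_fun \<alpha> (u z)"
        using f by (auto simp: class_P_def subordinate_def)
      \<comment> \<open>The formulas for \<open>\<psi>\<close> and f are known only on the disc.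
        There g agrees with the weighted composition, and it is a product of two members of the
        class, hence holomorphic.\<close>
      define g where "g z = h_fun \<alpha> (\<omega> z) * h_fun \<alpha> (u (\<phi> z))" for z
      have g: "weighted_comp \<psi> \<phi> f z = g z" if "z \<in> unit_disc" for z
        using \<phi> that by (simp add: weighted_comp_def g_def \<psi> u(2))
      have "(u \<circ> \<phi>) holomorphic_on unit_disc"
        using assms(3) u(1)
        by (intro holomorphic_on_compose_gen[where t = unit_disc])
           (auto simp: schwarz_function_def)
      then have "schwarz_function (\<lambda>z. u (\<phi> z))"
        using assms(3) u(1) by (auto simp: schwarz_function_def o_def image_subset_iff)
      then have "g holomorphic_on unit_disc"
        unfolding g_def
        using h_fun_compose_in_class_P[of _ \<alpha>] assms(4)
        by (intro holomorphic_on_mult) (auto simp: class_P_def)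
      then have "weighted_comp \<psi> \<phi> f holomorphic_on unit_disc"
        using g by (metis holomorphic_transform)
      moreover have "weighted_comp \<psi> \<phi> f 0 = 1"
        using assms(3,4) u(1) g[of 0] by (simp add: g_def schwarz_function_def h_fun_def)
      moreover have "cmod (g z - 1) < cmod (g z + \<alpha>)" if z: "z \<in> unit_disc" for z
      proof -
        have le: "cmod (u (\<phi> z)) \<le> cmod (\<phi> z)"
          using u(1) \<phi>[OF z]
          by (intro Schwarz_Lemma(1)) (auto simp: schwarz_function_def image_subset_iff)
        \<comment> \<open>The hypothesis concerns only the radius |\<open>\<phi> z\<close>|;
          \<open>F_term_pos_mono\<close> carries positivity down to the smaller radius |u
          (\<open>\<phi> z\<close>)|.\<close>
        then have "F_term \<alpha> (\<omega> z) (cmod (u (\<phi> z))) > 0"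
          using pos z \<phi>[OF z] by (intro F_term_pos_mono[OF _ le]) auto
        then have "cmod (\<omega> z + u (\<phi> z) + (\<alpha> - 1) * \<omega> z * u (\<phi> z))
            < cmod (1 + \<alpha> * \<omega> z * u (\<phi> z))"
          using F_term_le[of \<alpha> "\<omega> z" "u (\<phi> z)"]
          by (intro power2_less_imp_less[OF _ norm_ge_zero]) linarith
        moreover have "u (\<phi> z) \<noteq> 1"
          using le \<phi>[OF z] by auto
        ultimately show ?thesis
          using h_fun_mult_condition[OF assms(2) \<omega>[OF z]] by (simp add: g_def)
      qed
      ultimately show ?thesis
        using g by (simp add: class_P_iff[OF assms(2)])
    qed
    then show "preserves_class_P \<psi> \<phi> \<alpha>"
      by (auto simp: preserves_class_P_def)
  qed
  then show ?thesis
    by (simp add: F_term_def algebra_simps)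
qed

end
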